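(* Let $G_1$ be a connected graph and let $G_2$ be an arbitrary (not necessarily connected) graph, with $|V(G_1)|=m$ and $|V(G_2)|=n$, where both graphs have at least two vertices and neither $G_1$ nor $G_2$ is asymmetric. Then $fix(G_1\odot G_2)= m\, fix(G_2)$.
   Context: All graphs are finite and simple. A graph is asymmetric if its automorphism group consists only of the identity. For a graph $G$, a set $\mathcal{F}\subseteq V(G)$ is a fixing set of $G$ if the only automorphism of $G$ that fixes every vertex of $\mathcal{F}$ is the identity. The fixing number $fix(G)$ is the minimum cardinality of a fixing set of $G$. For graphs $G_1$, $G_2$ with $|V(G_1)|=m$, the corona product $G_1\odot G_2$ is the graph obtained by taking one copy of $G_1$ and $m$ disjoint copies of $G_2$, and joining every vertex of the $i$-th copy of $G_2$ by an edge to the $i$-th vertex of $G_1$, for $i=1,\ldots,m$. *)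

theory Defs
  imports "Graph_Theory.Graph_Theory"
begin

text \<open>
  A finite simple graph is a \<open>pair_graph\<close>: a finite loop-free symmetric digraph without parallel
  arcs, every undirected edge being represented by its two orientations.
\<close>

text \<open>
  Using \<open>permutes\<close> makes every automorphism the identity outside the vertex set, so that it is
  determined by its action on the vertices and the identity automorphism is \<open>id\<close>.
\<close>

definition automorphisms :: "'a pair_pre_digraph \<Rightarrow> ('a \<Rightarrow> 'a) set" where
  "automorphisms G = {f. f permutes pverts G \<and>
     (\<forall>u\<in>pverts G. \<forall>v\<in>pverts G. (u, v) \<in> parcs G \<longleftrightarrow> (f u, f v) \<in> parcs G)}"

definition asymmetric_graph :: "'a pair_pre_digraph \<Rightarrow> bool" where
  "asymmetric_graph G \<longleftrightarrow> automorphisms G = {id}"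

definition fixing_set :: "'a pair_pre_digraph \<Rightarrow> 'a set \<Rightarrow> bool" where
  "fixing_set G F \<longleftrightarrow> F \<subseteq> pverts G \<and>
     (\<forall>f\<in>automorphisms G. (\<forall>v\<in>F. f v = v) \<longrightarrow> f = id)"

definition fixing_number :: "'a pair_pre_digraph \<Rightarrow> nat" where
  "fixing_number G = (LEAST k. \<exists>F. fixing_set G F \<and> card F = k)"

text \<open>
  The copies of \<open>G2\<close> are indexed by the vertices of \<open>G1\<close> themselves instead of by \<open>1, \<dots>, m\<close>:
  \<open>Inl x\<close> is the vertex \<open>x\<close> of \<open>G1\<close>, and \<open>Inr (x, v)\<close> is the vertex \<open>v\<close> in the copy of \<open>G2\<close>
  attached to \<open>x\<close>.
\<close>

definition corona :: "'a pair_pre_digraph \<Rightarrow> 'b pair_pre_digraph \<Rightarrow> ('a + 'a \<times> 'b) pair_pre_digraph"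
    (infixl "\<odot>" 70) where
  "G1 \<odot> G2 = \<lparr>
     pverts = pverts G1 <+> (pverts G1 \<times> pverts G2),
     parcs = {(Inl x, Inl y) | x y. (x, y) \<in> parcs G1}
       \<union> {(Inr (x, u), Inr (x, v)) | x u v. x \<in> pverts G1 \<and> (u, v) \<in> parcs G2}
       \<union> {(Inl x, Inr (x, v)) | x v. x \<in> pverts G1 \<and> v \<in> pverts G2}
       \<union> {(Inr (x, v), Inl x) | x v. x \<in> pverts G1 \<and> v \<in> pverts G2}\<rparr>"

lemma pair_graph_corona:
  assumes "pair_graph G1" and "pair_graph G2"
  shows "pair_graph (G1 \<odot> G2)"
proof -
  interpret G1: pair_graph G1 by fact
  interpret G2: pair_graph G2 by fact
  have wf: "parcs (G1 \<odot> G2) \<subseteq> pverts (G1 \<odot> G2) \<times> pverts (G1 \<odot> G2)"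
    by (auto simp: corona_def dest: G1.in_arcsD1 G1.in_arcsD2 G2.in_arcsD1 G2.in_arcsD2)
  have fin: "finite (pverts (G1 \<odot> G2))"
    by (auto simp: corona_def G1.pair_finite_verts G2.pair_finite_verts)
  show ?thesis
  proof
    show "fst e \<in> pverts (G1 \<odot> G2)" "snd e \<in> pverts (G1 \<odot> G2)" if "e \<in> parcs (G1 \<odot> G2)" for e
      using wf that by auto
    show "finite (pverts (G1 \<odot> G2))" by (fact fin)
    show "finite (parcs (G1 \<odot> G2))"
      using finite_subset[OF wf] fin by blast
    show "fst e \<noteq> snd e" if "e \<in> parcs (G1 \<odot> G2)" for e
      using that by (auto simp: corona_def dest: G1.no_loops' G2.no_loops')
    show "symmetric (with_proj (G1 \<odot> G2))"
      unfolding symmetric_def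
      by (rule symI)
        (auto simp: corona_def dest: G1.arcs_symmetric G2.arcs_symmetric)
  qed
qed

text \<open>Agreement with the library's digraph isomorphisms.\<close>

lemma automorphisms_iff_digraph_isomorphism:
  assumes "pair_wf_digraph G" and f: "f permutes pverts G"
  shows "f \<in> automorphisms G \<longleftrightarrow>
    (\<exists>h. pre_digraph.digraph_isomorphism (with_proj G) h
       \<and> app_iso h (with_proj G) = with_proj G \<and> (\<forall>v\<in>pverts G. iso_verts h v = f v))"
    (is "_ \<longleftrightarrow> ?R")
proof
  interpret G: pair_wf_digraph G by fact
  assume "f \<in> automorphisms G"
  then have iff: "(u, v) \<in> parcs G \<longleftrightarrow> (f u, f v) \<in> parcs G"
    if "u \<in> pverts G" "v \<in> pverts G" for u v
    using that by (auto simp: automorphisms_def)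
  let ?h = "\<lparr>iso_verts = f, iso_arcs = map_prod f f, iso_head = snd, iso_tail = fst\<rparr>"
  have img: "map_prod f f ` parcs G = parcs G"
  proof
    show "map_prod f f ` parcs G \<subseteq> parcs G"
      using iff by (auto dest: G.in_arcsD1 G.in_arcsD2)
    show "parcs G \<subseteq> map_prod f f ` parcs G"
    proof clarify
      fix a b assume ab: "(a, b) \<in> parcs G"
      then have "a \<in> f ` pverts G" "b \<in> f ` pverts G"
        using permutes_image[OF f] G.in_arcsD1 G.in_arcsD2 by auto
      then obtain u v where "u \<in> pverts G" "v \<in> pverts G" "a = f u" "b = f v" by auto
      with ab iff show "(a, b) \<in> map_prod f f ` parcs G" by force
    qed
  qed
  have "pre_digraph.digraph_isomorphism (with_proj G) ?h"
    unfolding pre_digraph.digraph_isomorphism_def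
    using permutes_inj_on[OF f] permutes_inj[OF f]
    by (auto intro: G.wf_digraph inj_on_subset[OF prod.inj_map])
  moreover have "app_iso ?h (with_proj G) = with_proj G"
    using img permutes_image[OF f] by (simp add: app_iso_def with_proj_def)
  ultimately show ?R by (intro exI[of _ ?h]) simp
next
  interpret G: pair_wf_digraph G by fact
  assume ?R
  then obtain h where h: "pre_digraph.digraph_isomorphism (with_proj G) h"
    and app: "app_iso h (with_proj G) = with_proj G"
    and hf: "\<And>v. v \<in> pverts G \<Longrightarrow> iso_verts h v = f v" by blast
  have th: "iso_tail h = fst" "iso_head h = snd" and img: "iso_arcs h ` parcs G = parcs G"
    using app by (auto simp: app_iso_def with_proj_def)
  have arc: "iso_arcs h (u, v) = (f u, f v)" if uv: "(u, v) \<in> parcs G" for u v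
  proof -
    have "fst (iso_arcs h (u, v)) = iso_verts h u" "snd (iso_arcs h (u, v)) = iso_verts h v"
      using h uv th unfolding pre_digraph.digraph_isomorphism_def by auto
    then show ?thesis using hf G.in_arcsD1[OF uv] G.in_arcsD2[OF uv] by (simp add: prod_eq_iff)
  qed
  have "(u, v) \<in> parcs G \<longleftrightarrow> (f u, f v) \<in> parcs G" for u v
  proof
    show "(f u, f v) \<in> parcs G" if "(u, v) \<in> parcs G"
      using that arc img by (metis image_eqI)
    assume "(f u, f v) \<in> parcs G"
    then obtain a b where ab: "(a, b) \<in> parcs G" "(f u, f v) = iso_arcs h (a, b)"
      using img by (metis imageE prod.collapse)
    then have "f u = f a" "f v = f b" using arc by auto
    then show "(u, v) \<in> parcs G" using ab permutes_inj[OF f] by (auto dest: injD)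
  qed
  then show "f \<in> automorphisms G" using f by (auto simp: automorphisms_def)
qed

end

theory Submission
  imports Defs
begin

text \<open>
  In the corona a vertex of \<open>G1\<close> has degree at least \<open>n + 1\<close>, because \<open>G1\<close> is connected with
  \<open>m \<ge> 2\<close>, whereas a vertex of a copy of \<open>G2\<close> has degree at most \<open>n\<close>; so automorphisms preserve
  \<open>V(G1)\<close>. As \<open>G2\<close> is not asymmetric, its fixing sets are nonempty, and placing one in each copy
  pins down every vertex of \<open>G1\<close> as the only \<open>G1\<close>-neighbour of a fixed vertex, and hence every
  copy. Conversely, an automorphism of \<open>G2\<close> acts on any single copy, so a fixing set of the
  corona induces a fixing set of \<open>G2\<close> in every copy.
\<close>

section \<open>Automorphisms and fixing sets of an arbitrary graph\<close>

lemma automorphisms_permutes: "f \<in> automorphisms G \<Longrightarrow> f permutes pverts G"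
  by (simp add: automorphisms_def)

lemma automorphisms_arc_iff:
  "f \<in> automorphisms G \<Longrightarrow> u \<in> pverts G \<Longrightarrow> v \<in> pverts G \<Longrightarrow>
    (f u, f v) \<in> parcs G \<longleftrightarrow> (u, v) \<in> parcs G"
  by (simp add: automorphisms_def)

lemma id_in_automorphisms: "id \<in> automorphisms G"
  by (simp add: automorphisms_def permutes_id)

text \<open>Guarantees that the \<open>LEAST\<close> in \<open>fixing_number\<close> is attained. It
  relies on \<open>permutes\<close>, which already fixes everything outside the vertex set.\<close>

lemma fixing_set_pverts: "fixing_set G (pverts G)"
  unfolding fixing_set_def automorphisms_def by (auto simp: permutes_def fun_eq_iff)

lemma fixing_number_le: "fixing_set G F \<Longrightarrow> fixing_number G \<le> card F"
  unfolding fixing_number_def by (rule Least_le) auto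

lemma fixing_number_attained:
  obtains F where "fixing_set G F" "card F = fixing_number G"
proof -
  have "\<exists>F. fixing_set G F \<and> card F = fixing_number G"
    unfolding fixing_number_def
    by (rule LeastI_ex[of "\<lambda>k. \<exists>F. fixing_set G F \<and> card F = k"]) (use fixing_set_pverts in blast)
  then show thesis using that by blast
qed

lemma fixing_set_nonempty:
  assumes "fixing_set G F" and "\<not> asymmetric_graph G"
  shows "F \<noteq> {}"
proof
  assume "F = {}"
  with assms(1) have "automorphisms G \<subseteq> {id}" by (auto simp: fixing_set_def)
  with assms(2) show False
    using id_in_automorphisms[of G] by (auto simp: asymmetric_graph_def)
qed

section \<open>Degrees, as cardinalities of out-neighbourhoods\<close>

context pair_graph
begin

lemma connected_imp_neighbour:
  assumes "connected (with_proj G)" and "2 \<le> card (pverts G)" and "x \<in> pverts G"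
  obtains y where "(x, y) \<in> parcs G"
proof -
  have "pverts G \<noteq> {x}" using assms(2) by auto
  then obtain z where z: "z \<in> pverts G" "z \<noteq> x" using assms(3) by blast
  have "x \<rightarrow>\<^sup>*\<^bsub>with_proj G\<^esub> z"
    using symmetric_connected_imp_strongly_connected[OF pair_sym_arcs assms(1)] assms(3) z(1)
    unfolding strongly_connected_def by simp
  \<comment> \<open>Since \<open>z\<close> differs from \<open>x\<close>, the walk from
    \<open>x\<close> to \<open>z\<close> has a first arc.\<close>
  then have "\<exists>y. (x, y) \<in> parcs G"
    using z(2) by (cases rule: pre_digraph.converse_reachable_cases) auto
  then show thesis using that by blast
qed

text \<open>An automorphism maps the neighbourhood of \<open>u\<close> bijectively onto that of
  \<open>f u\<close>.\<close>

lemma card_neighbours_automorphism: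
  assumes f: "f \<in> automorphisms G" and u: "u \<in> pverts G"
  shows "card {w. (f u, w) \<in> parcs G} = card {w. (u, w) \<in> parcs G}"
proof -
  have p: "f permutes pverts G" using f by (rule automorphisms_permutes)
  have "{w. (f u, w) \<in> parcs G} = f ` {w. (u, w) \<in> parcs G}"
  proof safe
    fix w assume w: "(f u, w) \<in> parcs G"
    then obtain v where "v \<in> pverts G" "w = f v"
      using in_arcsD2 permutes_image[OF p] by blast
    then show "w \<in> f ` {w. (u, w) \<in> parcs G}"
      using w automorphisms_arc_iff[OF f u] by auto
  next
    fix w assume "(u, w) \<in> parcs G"
    then show "(f u, f w) \<in> parcs G"
      using automorphisms_arc_iff[OF f u] in_arcsD2 by auto
  qed
  then show ?thesis using permutes_inj_on[OF p] by (simp add: card_image)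
qed

end

section \<open>The corona and its automorphisms\<close>

lemma corona_verts [simp]:
  "Inl x \<in> pverts (G1 \<odot> G2) \<longleftrightarrow> x \<in> pverts G1"
  "Inr (x, v) \<in> pverts (G1 \<odot> G2) \<longleftrightarrow> x \<in> pverts G1 \<and> v \<in> pverts G2"
  by (auto simp: corona_def)

lemma corona_arcs [simp]:
  "(Inl x, Inl y) \<in> parcs (G1 \<odot> G2) \<longleftrightarrow> (x, y) \<in> parcs G1"
  "(Inl x, Inr (y, v)) \<in> parcs (G1 \<odot> G2) \<longleftrightarrow> y = x \<and> x \<in> pverts G1 \<and> v \<in> pverts G2"
  "(Inr (x, v), Inl y) \<in> parcs (G1 \<odot> G2) \<longleftrightarrow> y = x \<and> x \<in> pverts G1 \<and> v \<in> pverts G2"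
  "(Inr (x, u), Inr (y, v)) \<in> parcs (G1 \<odot> G2) \<longleftrightarrow> y = x \<and> x \<in> pverts G1 \<and> (u, v) \<in> parcs G2"
  by (auto simp: corona_def)

lemma corona_automorphism_Inl:
  assumes "pair_graph G1" and "pair_graph G2"
    and conn: "connected (with_proj G1)" and two: "2 \<le> card (pverts G1)"
    and f: "f \<in> automorphisms (G1 \<odot> G2)" and x: "x \<in> pverts G1"
  obtains y where "y \<in> pverts G1" "f (Inl x) = Inl y"
proof (cases "f (Inl x)")
  case (Inl y)
  have "f (Inl x) \<in> pverts (G1 \<odot> G2)"
    using automorphisms_permutes[OF f] x by (simp add: permutes_in_image)
  with Inl show thesis by (intro that) auto
next
  \<comment> \<open>This case is contradictory: the chain of estimates below ends in
    \<open>Suc n \<le> n\<close> with \<open>n = card (pverts G2)\<close>.\<close>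
  case (Inr p)
  interpret G1: pair_graph G1 by fact
  interpret G2: pair_graph G2 by fact
  interpret C: pair_graph "G1 \<odot> G2" by (intro pair_graph_corona assms)
  obtain y v where p: "p = (y, v)" by (cases p)
  have "f (Inl x) \<in> pverts (G1 \<odot> G2)"
    using automorphisms_permutes[OF f] x by (simp add: permutes_in_image)
  with Inr p have yv: "y \<in> pverts G1" "v \<in> pverts G2" by auto
  let ?N = "\<lambda>a. {w. (a, w) \<in> parcs (G1 \<odot> G2)}"
  obtain z where z: "(x, z) \<in> parcs G1"
    using G1.connected_imp_neighbour[OF conn two x] .
  have inj: "inj_on (\<lambda>u. Inr (a, u)) A" for a :: 'a and A :: "'b set"
    by (auto simp: inj_on_def)
  have "?N (Inl x) \<subseteq> pverts (G1 \<odot> G2)"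
    by (auto dest: C.in_arcsD2)
  then have fin: "finite (?N (Inl x))"
    by (rule finite_subset) (rule C.pair_finite_verts)
  \<comment> \<open>\<open>Inl x\<close> is adjacent to its whole copy of \<open>G2\<close> and to
    at least one further vertex \<open>Inl z\<close>.\<close>
  have "Suc (card (pverts G2)) = card (insert (Inl z) ((\<lambda>u. Inr (x, u)) ` pverts G2))"
    by (subst card_insert_disjoint) (auto simp: card_image[OF inj] G2.pair_finite_verts)
  also have "\<dots> \<le> card (?N (Inl x))"
    using x z by (intro card_mono[OF fin]) auto
  also have "\<dots> = card (?N (Inr (y, v)))"
    using C.card_neighbours_automorphism[OF f, of "Inl x"] x Inr p by simp
  \<comment> \<open>A copy vertex sees only its centre \<open>Inl y\<close> and other vertices of
    its own copy; excluding \<open>v\<close> itself, by looplessness, is what makes the bound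
    \<open>n\<close> instead of \<open>n + 1\<close>.\<close>
  also have "\<dots> \<le> card (insert (Inl y) ((\<lambda>u. Inr (y, u)) ` (pverts G2 - {v})))"
  proof (rule card_mono)
    show "?N (Inr (y, v)) \<subseteq> insert (Inl y) ((\<lambda>u. Inr (y, u)) ` (pverts G2 - {v}))"
    proof
      fix w assume w: "w \<in> ?N (Inr (y, v))"
      show "w \<in> insert (Inl y) ((\<lambda>u. Inr (y, u)) ` (pverts G2 - {v}))"
      proof (cases w)
        case (Inr q)
        then obtain u where q: "w = Inr (y, u)" "(v, u) \<in> parcs G2"
          using w by (cases q) auto
        then have "u \<in> pverts G2 - {v}" by (auto dest: G2.in_arcsD2 G2.no_loops')
        with q(1) show ?thesis by blast
      qed (use w in auto)
    qed
  qed (simp add: G2.pair_finite_verts)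
  also have "\<dots> = Suc (card (pverts G2 - {v}))"
    by (subst card_insert_disjoint) (auto simp: card_image[OF inj] G2.pair_finite_verts)
  also have "\<dots> = card (pverts G2)"
    using yv G2.pair_finite_verts by (metis card.remove)
  finally show thesis by simp
qed

lemma fixing_set_corona:
  assumes G1: "pair_graph G1" and G2: "pair_graph G2"
    and conn: "connected (with_proj G1)" and two: "2 \<le> card (pverts G1)"
    and F: "fixing_set G2 F" and ne: "F \<noteq> {}"
  shows "fixing_set (G1 \<odot> G2) (Inr ` (pverts G1 \<times> F))"
  unfolding fixing_set_def
proof (intro conjI ballI impI)
  have fin: "finite (pverts G2)"
  proof -
    interpret G2: pair_graph G2 by fact
    show ?thesis by (rule G2.pair_finite_verts)
  qed
  have sub: "F \<subseteq> pverts G2" using F by (simp add: fixing_set_def)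
  then show "Inr ` (pverts G1 \<times> F) \<subseteq> pverts (G1 \<odot> G2)" by auto
  fix f assume f: "f \<in> automorphisms (G1 \<odot> G2)"
    and fixed: "\<forall>v\<in>Inr ` (pverts G1 \<times> F). f v = v"
  have p: "f permutes pverts (G1 \<odot> G2)" using f by (rule automorphisms_permutes)
  note arc = automorphisms_arc_iff[OF f]
  \<comment> \<open>The fixed vertex \<open>Inr (x, v)\<close> with \<open>v\<close> in
    \<open>F\<close> is adjacent to the image of \<open>Inl x\<close>, and \<open>Inl x\<close> is
    its only neighbour of the form \<open>Inl y\<close>.\<close>
  have Inl: "f (Inl x) = Inl x" if x: "x \<in> pverts G1" for x
  proof -
    obtain y where y: "f (Inl x) = Inl y"
      using corona_automorphism_Inl[OF G1 G2 conn two f x] .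
    obtain v where "v \<in> F" using ne by blast
    then show ?thesis
      using arc[of "Inl x" "Inr (x, v)"] x y sub fixed by auto
  qed
  \<comment> \<open>The image stays adjacent to the fixed vertex \<open>Inl x\<close>. It cannot be
    some \<open>Inl y\<close>, because that vertex is already its own image and \<open>f\<close> is
    injective.\<close>
  have copy: "\<exists>w. w \<in> pverts G2 \<and> f (Inr (x, v)) = Inr (x, w)"
    if x: "x \<in> pverts G1" and v: "v \<in> pverts G2" for x v
  proof -
    have adj: "(Inl x, f (Inr (x, v))) \<in> parcs (G1 \<odot> G2)"
      using arc[of "Inl x" "Inr (x, v)"] x v Inl by auto
    show ?thesis
    proof (cases "f (Inr (x, v))")
      case (Inl y)
      have "f (Inr (x, v)) \<in> pverts (G1 \<odot> G2)"
        using x v by (simp add: permutes_in_image[OF p])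
      then have "f (Inl y) = Inl y" using Inl \<open>\<And>x. x \<in> pverts G1 \<Longrightarrow> f (Inl x) = Inl x\<close> by auto
      then have "f (Inl y) = f (Inr (x, v))" using Inl by simp
      then show ?thesis using injD[OF permutes_inj[OF p]] by blast
    next
      case (Inr q)
      then show ?thesis using adj by (cases q) auto
    qed
  qed
  have Inr: "f (Inr (x, v)) = Inr (x, v)" if x: "x \<in> pverts G1" and v: "v \<in> pverts G2" for x v
  proof -
    \<comment> \<open>The action of \<open>f\<close> on the copy at \<open>x\<close>, read as a map
      on \<open>G2\<close>; the default value \<open>u\<close> outside the vertex set is needed for
      \<open>g permutes pverts G2\<close>.\<close>
    define g where "g u = (if u \<in> pverts G2 then snd (projr (f (Inr (x, u)))) else u)" for u
    have g: "g u \<in> pverts G2 \<and> f (Inr (x, u)) = Inr (x, g u)" if "u \<in> pverts G2" for u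
      using copy[OF x that] that by (auto simp: g_def)
    have inj: "inj_on g (pverts G2)"
    proof (rule inj_onI)
      fix a b assume ab: "a \<in> pverts G2" "b \<in> pverts G2" "g a = g b"
      then have "f (Inr (x, a)) = f (Inr (x, b))" using g by simp
      then show "a = b" using injD[OF permutes_inj[OF p]] by blast
    qed
    have "g ` pverts G2 \<subseteq> pverts G2" using g by auto
    then have "bij_betw g (pverts G2) (pverts G2)"
      using inj fin by (simp add: bij_betw_def endo_inj_surj)
    then have "g permutes pverts G2"
      by (rule bij_imp_permutes) (simp add: g_def)
    moreover have "(u, w) \<in> parcs G2 \<longleftrightarrow> (g u, g w) \<in> parcs G2"
      if "u \<in> pverts G2" "w \<in> pverts G2" for u w
      using arc[of "Inr (x, u)" "Inr (x, w)"] x that g by auto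
    ultimately have "g \<in> automorphisms G2" by (simp add: automorphisms_def)
    moreover have "g u = u" if "u \<in> F" for u
      using g[of u] sub fixed x that by auto
    ultimately have "g = id" using F by (auto simp: fixing_set_def)
    then show ?thesis using g[OF v] by simp
  qed
  show "f = id"
  proof
    fix a show "f a = id a"
    proof (cases "a \<in> pverts (G1 \<odot> G2)")
      case True
      then show ?thesis using Inl Inr by (cases a) auto
    next
      case False
      then show ?thesis using permutes_not_in[OF p] by simp
    qed
  qed
qed

text \<open>An automorphism of \<open>G2\<close> fixing the trace of \<open>F\<close> on the copy at
  \<open>x\<close> extends by the identity to an automorphism of the corona that fixes
  \<open>F\<close>, so it must be trivial.\<close>

lemma fixing_set_corona_copy:
  assumes F: "fixing_set (G1 \<odot> G2) F" and x: "x \<in> pverts G1"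
  shows "fixing_set G2 {v. Inr (x, v) \<in> F}"
  unfolding fixing_set_def
proof (intro conjI ballI impI)
  show "{v. Inr (x, v) \<in> F} \<subseteq> pverts G2"
    using F by (auto simp: fixing_set_def)
  fix g assume g: "g \<in> automorphisms G2" and fixed: "\<forall>v\<in>{v. Inr (x, v) \<in> F}. g v = v"
  have p: "g permutes pverts G2" using g by (rule automorphisms_permutes)
  \<comment> \<open>The extension by the identity. The map \<open>k\<close> is a parameter so that
    \<open>h (inv g)\<close> can serve as the inverse of \<open>h g\<close>.\<close>
  define h where "h k a = (case a of Inl y \<Rightarrow> Inl y
    | Inr (y, v) \<Rightarrow> if y = x then Inr (y, k v) else Inr (y, v))"
    for k :: "'b \<Rightarrow> 'b" and a :: "'a + 'a \<times> 'b"
  have h_simps: "h k (Inl y) = Inl y" "h k (Inr (y, v)) = Inr (y, if y = x then k v else v)" for k y v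
    by (auto simp: h_def)
  have "bij_betw (h g) (pverts (G1 \<odot> G2)) (pverts (G1 \<odot> G2))"
  proof (rule bij_betw_byWitness[of _ "h (inv g)"])
    have inv: "h (inv g) (h g a) = a \<and> h g (h (inv g) a) = a" for a
    proof (cases a)
      case (Inr q)
      then show ?thesis by (cases q) (simp add: h_simps permutes_inverses[OF p])
    qed (simp add: h_simps)
    then show "\<forall>a\<in>pverts (G1 \<odot> G2). h (inv g) (h g a) = a"
      and "\<forall>a\<in>pverts (G1 \<odot> G2). h g (h (inv g) a) = a" by simp_all
    have "h k a \<in> pverts (G1 \<odot> G2)"
      if "k permutes pverts G2" "a \<in> pverts (G1 \<odot> G2)" for k a
      using that by (cases a) (auto simp: h_simps permutes_in_image)
    then show "h g ` pverts (G1 \<odot> G2) \<subseteq> pverts (G1 \<odot> G2)"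
      and "h (inv g) ` pverts (G1 \<odot> G2) \<subseteq> pverts (G1 \<odot> G2)"
      using p permutes_inv[OF p] by blast+
  qed
  moreover have "h g a = a" if "a \<notin> pverts (G1 \<odot> G2)" for a
    using that x permutes_not_in[OF p] by (cases a) (auto simp: h_simps)
  ultimately have "h g permutes pverts (G1 \<odot> G2)"
    by (rule bij_imp_permutes)
  moreover have "(a, b) \<in> parcs (G1 \<odot> G2) \<longleftrightarrow> (h g a, h g b) \<in> parcs (G1 \<odot> G2)"
    if "a \<in> pverts (G1 \<odot> G2)" "b \<in> pverts (G1 \<odot> G2)" for a b
    using that
    by (cases a; cases b)
      (auto simp: h_simps permutes_in_image[OF p] automorphisms_arc_iff[OF g] split: if_splits)
  ultimately have "h g \<in> automorphisms (G1 \<odot> G2)" by (simp add: automorphisms_def)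
  moreover have "h g a = a" if "a \<in> F" for a
    using that fixed by (cases a) (auto simp: h_simps)
  ultimately have "h g = id" using F by (auto simp: fixing_set_def)
  then have "h g (Inr (x, v)) = Inr (x, v)" for v by simp
  then show "g = id" by (auto simp: h_simps fun_eq_iff)
qed

theorem theorem3p7:
  fixes G1 :: "'a pair_pre_digraph" and G2 :: "'b pair_pre_digraph" and m n :: nat
  assumes "pair_graph G1" and "pair_graph G2"
    and "connected (with_proj G1)"
    and "card (pverts G1) = m" and "card (pverts G2) = n"
    and "2 \<le> m" and "2 \<le> n"
    and "\<not> asymmetric_graph G1" and "\<not> asymmetric_graph G2"
  shows "fixing_number (G1 \<odot> G2) = m * fixing_number G2"
proof (rule antisym)
  obtain F where F: "fixing_set G2 F" "card F = fixing_number G2"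
    by (rule fixing_number_attained)
  \<comment> \<open>Upper bound: one copy of a minimum fixing set of \<open>G2\<close> at each
    vertex of \<open>G1\<close>.\<close>
  have "fixing_set (G1 \<odot> G2) (Inr ` (pverts G1 \<times> F))"
    using assms F fixing_set_nonempty by (intro fixing_set_corona) auto
  then have "fixing_number (G1 \<odot> G2) \<le> card (Inr ` (pverts G1 \<times> F) :: ('a + 'a \<times> 'b) set)"
    by (rule fixing_number_le)
  also have "\<dots> = m * fixing_number G2"
    using F assms by (simp add: card_image card_cartesian_product)
  finally show "fixing_number (G1 \<odot> G2) \<le> m * fixing_number G2" .
next
  interpret G1: pair_graph G1 by fact
  interpret G2: pair_graph G2 by fact
  interpret C: pair_graph "G1 \<odot> G2" by (intro pair_graph_corona assms)
  obtain F where F: "fixing_set (G1 \<odot> G2) F" "card F = fixing_number (G1 \<odot> G2)"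
    by (rule fixing_number_attained)
  \<comment> \<open>Lower bound: cut a minimum fixing set of the corona into its traces on the
    copies, each of which has at least \<open>fixing_number G2\<close> elements.\<close>
  define A where "A x = {v. Inr (x, v) \<in> F}" for x
  have A: "fixing_set G2 (A x)" if "x \<in> pverts G1" for x
    unfolding A_def using F(1) that by (rule fixing_set_corona_copy)
  then have fin: "finite (A x)" if "x \<in> pverts G1" for x
    using that finite_subset[OF _ G2.pair_finite_verts] by (auto simp: fixing_set_def)
  have "m * fixing_number G2 = (\<Sum>x\<in>pverts G1. fixing_number G2)"
    using assms by simp
  also have "\<dots> \<le> (\<Sum>x\<in>pverts G1. card (A x))"
    using A by (intro sum_mono fixing_number_le)
  \<comment> \<open>Tagging each trace with its index \<open>x\<close> makes the traces disjoint and
    embeds their union in \<open>F\<close>; any elements \<open>Inl y\<close> of \<open>F\<close>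
    are dropped, so only an inequality follows.\<close>
  also have "\<dots> = card (Inr ` (SIGMA x:pverts G1. A x) :: ('a + 'a \<times> 'b) set)"
    using fin G1.pair_finite_verts by (simp add: card_image card_SigmaI)
  also have "\<dots> \<le> card F"
  proof (rule card_mono)
    show "finite F"
      using F(1) finite_subset[OF _ C.pair_finite_verts] by (auto simp: fixing_set_def)
  qed (auto simp: A_def)
  finally show "m * fixing_number G2 \<le> fixing_number (G1 \<odot> G2)" using F(2) by simp
qed

end
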